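(* Let $\Gamma$ be a graph with $P_4\leq\Gamma$ and let $v$ be such that a $(K_v,\Gamma)$-design exists. Then $$\{n\geq v+2 \mid n\equiv 0,1\pmod 3\}\subseteq \mathcal{L}_2\Gamma(v)\subseteq \mathcal{L}_1\Gamma(v).$$
   Context: Graphs are finite and simple; $\Gamma'\leq\Gamma$ means that $\Gamma'$ is (isomorphic to) a subgraph of $\Gamma$. $K_n$ is the complete graph on $n$ vertices and $P_4$ is the path with $4$ vertices and $3$ edges. For graphs $\Gamma\leq K$, a $(K,\Gamma)$-design is a set of subgraphs of $K$, called blocks, each isomorphic to $\Gamma$, whose edge sets partition $E(K)$. A $(K_v,\Gamma)$-design is also called a $\Gamma$-design of order $v$. Given a $(K,\Gamma)$-design $\mathcal B$ and a $(K',\Gamma')$-design $\mathcal B'$ with $\Gamma'\leq\Gamma$, a down-link from $\mathcal B$ to $\mathcal B'$ is a function $f:\mathcal B\to\mathcal B'$ such that, for every $B\in\mathcal B$, $f(B)$ is a subgraph of $B$ (as an actual graph on the given vertices, not merely up to isomorphism). The complete graphs $K=K_v$ and $K'=K_n$ may have different vertex sets. When such an $f$ exists, $\mathcal B$ is said to be down-linked to $\mathcal B'$. Throughout, the target graph is $\Gamma'=P_4$. $\mathcal{L}_1\Gamma(v)$ is the set of all integers $n$ such that there exists some $\Gamma$-design of order $v$ that can be down-linked to some $P_4$-design of order $n$. $\mathcal{L}_2\Gamma(v)$ is the set of all integers $n$ such that every $\Gamma$-design of order $v$ can be down-linked to some $P_4$-design of order $n$. *)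

theory Defs
  imports
    "HOL-Library.Disjoint_Sets"
    "HOL-Library.FuncSet"
    "HOL-Library.Infinite_Typeclass"
    "HOL-Number_Theory.Cong"
begin

datatype 'a graph = Graph (verts: "'a set") (edges: "'a set set")

definition simple_graph :: "'a graph \<Rightarrow> bool" where
  "simple_graph G \<longleftrightarrow> finite (verts G) \<and> (\<forall>e\<in>edges G. e \<subseteq> verts G \<and> card e = 2)"

definition complete_graph :: "'a set \<Rightarrow> 'a graph" where
  "complete_graph V = Graph V {e. e \<subseteq> V \<and> card e = 2}"

definition P4 :: "nat graph" where
  "P4 = Graph {0, 1, 2, 3} {{0, 1}, {1, 2}, {2, 3}}"

definition subgraph :: "'a graph \<Rightarrow> 'a graph \<Rightarrow> bool" where
  "subgraph H G \<longleftrightarrow> simple_graph H \<and> simple_graph G \<and> verts H \<subseteq> verts G \<and> edges H \<subseteq> edges G"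

definition graph_iso :: "'a graph \<Rightarrow> 'b graph \<Rightarrow> bool" where
  "graph_iso G H \<longleftrightarrow> (\<exists>\<phi>. bij_betw \<phi> (verts G) (verts H) \<and> edges H = (\<lambda>e. \<phi> ` e) ` edges G)"

definition embeds :: "'b graph \<Rightarrow> 'a graph \<Rightarrow> bool" (infix "\<lesssim>\<^sub>G" 50) where
  "H \<lesssim>\<^sub>G G \<longleftrightarrow> (\<exists>S. subgraph S G \<and> graph_iso S H)"

text \<open>Injectivity of \<open>edges\<close> makes distinct blocks have distinct, hence disjoint, edge sets.
  If \<open>\<Gamma>\<close> has an edge, the condition that \<open>\<Gamma>\<close> embeds in \<open>K\<close> excludes the empty
  block set on an edgeless \<open>K\<close>.\<close>

definition design :: "'a graph \<Rightarrow> 'b graph \<Rightarrow> 'a graph set \<Rightarrow> bool" where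
  "design K \<Gamma> Bs \<longleftrightarrow>
     \<Gamma> \<lesssim>\<^sub>G K \<and>
     (\<forall>B\<in>Bs. subgraph B K \<and> graph_iso B \<Gamma>) \<and>
     inj_on edges Bs \<and> partition_on (edges K) (edges ` Bs)"

definition design_of_order :: "nat \<Rightarrow> 'b graph \<Rightarrow> 'a graph set \<Rightarrow> bool" where
  "design_of_order v \<Gamma> Bs \<longleftrightarrow>
     (\<exists>V. finite V \<and> card V = v \<and> design (complete_graph V) \<Gamma> Bs)"

definition down_link :: "('a graph \<Rightarrow> 'a graph) \<Rightarrow> 'a graph set \<Rightarrow> 'a graph set \<Rightarrow> bool" where
  "down_link f Bs Bs' \<longleftrightarrow> f \<in> Bs \<rightarrow> Bs' \<and> (\<forall>B\<in>Bs. subgraph (f B) B)"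

definition down_linked :: "'a graph set \<Rightarrow> 'a graph set \<Rightarrow> bool" where
  "down_linked Bs Bs' \<longleftrightarrow> (\<exists>f. down_link f Bs Bs')"

text \<open>All vertex sets are finite subsets of one infinite type \<open>'a\<close>. The vertex sets of the two
  designs are otherwise unrelated, and infinity of \<open>'a\<close> guarantees that a target design of any
  order is available, wherever the vertices of the source design lie.\<close>

definition L1 :: "'a::infinite graph \<Rightarrow> nat \<Rightarrow> nat set" where
  "L1 \<Gamma> v = {n. \<exists>Bs Bs' :: 'a graph set.
     design_of_order v \<Gamma> Bs \<and> design_of_order n P4 Bs' \<and> down_linked Bs Bs'}"

definition L2 :: "'a::infinite graph \<Rightarrow> nat \<Rightarrow> nat set" where
  "L2 \<Gamma> v = {n. \<forall>Bs :: 'a graph set. design_of_order v \<Gamma> Bs \<longrightarrow>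
     (\<exists>Bs'. design_of_order n P4 Bs' \<and> down_linked Bs Bs')}"

end

theory Submission
  imports Defs
begin

text \<open>Choose a copy of \<open>P4\<close> in every block. These copies are edge-disjoint, and the task is to
  complete them to a \<open>P4\<close>-design on \<open>n\<close> vertices. Put all but two vertices \<open>a\<close>, \<open>b\<close> of
  \<open>K\<^sub>n\<close> into one set \<open>V\<close>; what remains to be decomposed is an arbitrary graph \<open>E\<close> on \<open>V\<close>
  together with the edge \<open>ab\<close> and all edges from \<open>V\<close> to \<open>a\<close> and \<open>b\<close>. Divisibility of the number
  of edges by 3 suffices: copies of \<open>P4\<close> inside \<open>E\<close> are removed greedily, after which the
  components of \<open>E\<close> are triangles and stars. A triangle together with its six edges to \<open>a\<close>, \<open>b\<close>
  decomposes, and so do two leaves of a star together with their six edges. Only a matching is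
  left, whose components (isolated vertices included) are treated in groups of three, except for
  one edge or four isolated vertices, which absorb \<open>ab\<close>. A single isolated vertex could not
  absorb \<open>ab\<close>, so a triangle or a pair of leaves whose removal would leave only one vertex is
  decomposed together with that vertex and \<open>ab\<close>.\<close>

section \<open>Edge sets, and the edges to two special vertices\<close>

definition pairs :: "'a set \<Rightarrow> 'a set set" where
  "pairs V = {e. e \<subseteq> V \<and> card e = 2}"

definition path4 :: "'a \<Rightarrow> 'a \<Rightarrow> 'a \<Rightarrow> 'a \<Rightarrow> 'a set set" where
  "path4 x y z w = {{x, y}, {y, z}, {z, w}}"

definition is_path4 :: "'a set set \<Rightarrow> bool" where
  "is_path4 P \<longleftrightarrow> (\<exists>x y z w. distinct [x, y, z, w] \<and> P = path4 x y z w)"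

definition path4_decomposable :: "'a set set \<Rightarrow> bool" where
  "path4_decomposable X \<longleftrightarrow> (\<exists>\<P>. partition_on X \<P> \<and> (\<forall>P\<in>\<P>. is_path4 P))"

definition spokes :: "'a \<Rightarrow> 'a \<Rightarrow> 'a set \<Rightarrow> 'a set set" where
  "spokes a b V = (\<lambda>x. {x, a}) ` V \<union> (\<lambda>x. {x, b}) ` V"

definition incident :: "'a set set \<Rightarrow> 'a set \<Rightarrow> 'a set set" where
  "incident E S = {e \<in> E. e \<inter> S \<noteq> {}}"

lemma pairs_iff: "e \<in> pairs V \<longleftrightarrow> (\<exists>x y. e = {x, y} \<and> x \<noteq> y \<and> x \<in> V \<and> y \<in> V)"
  by (auto simp: pairs_def card_2_iff)

lemma pairs_obtain_other_end:
  assumes "e \<in> pairs V" "x \<in> e"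
  obtains y where "e = {x, y}" "x \<noteq> y" "x \<in> V" "y \<in> V"
proof -
  obtain u w where "e = {u, w}" "u \<noteq> w" "u \<in> V" "w \<in> V"
    using assms(1) by (auto simp: pairs_iff)
  then show ?thesis
    using that[of u] that[of w] assms(2) by (auto simp: insert_commute)
qed

lemma finite_pairs: "finite V \<Longrightarrow> finite (pairs V)"
  by (simp add: pairs_def)

lemma pairs_empty [simp]: "pairs {} = {}"
  by (auto simp: pairs_def)

lemma pairs_eq_empty:
  assumes "finite V" "card V < 2"
  shows "pairs V = {}"
proof (rule ccontr)
  assume "pairs V \<noteq> {}"
  then obtain e where "e \<subseteq> V" "card e = 2"
    unfolding pairs_def by blast
  then show False
    using card_mono[OF assms(1), of e] assms(2) by simp
qed

lemma spokes_simps [simp]: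
  "spokes a b {} = {}"
  "spokes a b (insert x V) = {{x, a}, {x, b}} \<union> spokes a b V"
  by (auto simp: spokes_def)

lemma spokes_Un: "spokes a b (V \<union> W) = spokes a b V \<union> spokes a b W"
  by (auto simp: spokes_def)

lemma spokes_commute: "spokes a b V = spokes b a V"
  by (auto simp: spokes_def)

lemma finite_spokes: "finite V \<Longrightarrow> finite (spokes a b V)"
  by (simp add: spokes_def)

lemma card_spokes:
  assumes "finite V" "a \<notin> V" "b \<notin> V" "a \<noteq> b"
  shows "card (spokes a b V) = 2 * card V"
proof -
  have "inj_on (\<lambda>x. {x, c}) V" for c
    by (auto simp: inj_on_def doubleton_eq_iff)
  moreover have "(\<lambda>x. {x, a}) ` V \<inter> (\<lambda>x. {x, b}) ` V = {}"
    using assms by (auto simp: doubleton_eq_iff)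
  ultimately show ?thesis
    using assms(1) by (simp add: spokes_def card_Un_disjoint card_image)
qed

lemma pairs_Int_spokes: "a \<notin> V \<Longrightarrow> b \<notin> V \<Longrightarrow> pairs V \<inter> spokes a b W = {}"
  by (auto simp: pairs_def spokes_def)

section \<open>Decompositions of edge sets into paths\<close>

lemma card_path4: "distinct [x, y, z, w] \<Longrightarrow> card (path4 x y z w) = 3"
  by (auto simp: path4_def doubleton_eq_iff)

lemma decomposable_empty: "path4_decomposable {}"
  unfolding path4_decomposable_def by (intro exI[of _ "{}"]) (simp add: partition_on_def)

lemma decomposable_path4:
  assumes "distinct [x, y, z, w]"
  shows "path4_decomposable (path4 x y z w)"
  unfolding path4_decomposable_def
proof (intro exI[of _ "{path4 x y z w}"] conjI)
  show "partition_on (path4 x y z w) {path4 x y z w}"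
    by (auto simp: partition_on_def path4_def)
qed (use assms in \<open>auto simp: is_path4_def\<close>)

lemma partition_on_Un_disjoint:
  assumes "partition_on X \<P>" "partition_on Y \<Q>" "X \<inter> Y = {}"
  shows "partition_on (X \<union> Y) (\<P> \<union> \<Q>)"
proof (rule partition_onI)
  show "\<Union>(\<P> \<union> \<Q>) = X \<union> Y"
    using assms by (simp add: partition_on_def)
  have "disjoint (\<P> \<union> \<Q>)"
    using assms by (intro disjoint_union) (auto simp: partition_on_def)
  then show "disjnt p q" if "p \<in> \<P> \<union> \<Q>" "q \<in> \<P> \<union> \<Q>" "p \<noteq> q" for p q
    using that by (simp add: pairwise_def)
  show "{} \<notin> \<P> \<union> \<Q>"
    using assms by (simp add: partition_on_def)
qed

lemma decomposable_Un:
  assumes "path4_decomposable X" "path4_decomposable Y" "X \<inter> Y = {}"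
  shows "path4_decomposable (X \<union> Y)"
proof -
  obtain \<P> \<Q> where "partition_on X \<P>" "\<forall>P\<in>\<P>. is_path4 P" "partition_on Y \<Q>" "\<forall>P\<in>\<Q>. is_path4 P"
    using assms unfolding path4_decomposable_def by blast
  then have "partition_on (X \<union> Y) (\<P> \<union> \<Q>)" "\<forall>P\<in>\<P> \<union> \<Q>. is_path4 P"
    using assms(3) partition_on_Un_disjoint by blast+
  then show ?thesis
    unfolding path4_decomposable_def by blast
qed

lemma decomposable_3_dvd:
  assumes "path4_decomposable X" "finite X"
  shows "3 dvd card X"
proof -
  from assms obtain \<P> where P: "partition_on X \<P>" and Q: "\<forall>P\<in>\<P>. is_path4 P"
    unfolding path4_decomposable_def by auto
  have c: "card A = 3" if "A \<in> \<P>" for A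
    using that Q card_path4 unfolding is_path4_def by metis
  have X: "\<Union>\<P> = X" and d: "pairwise disjnt \<P>"
    using P by (auto simp: partition_on_def disjoint_def pairwise_def disjnt_def)
  have "card (\<Union>\<P>) = (\<Sum>A\<in>\<P>. card A)"
    using d by (intro card_Union_disjoint) (auto simp: c intro!: card_ge_0_finite)
  then show ?thesis using X c by (simp add: dvd_sum)
qed

text \<open>Carries the divisibility condition through every removal, since a decomposable piece has
  a multiple of three edges.\<close>

lemma dvd_card_remove:
  assumes "path4_decomposable P" "finite (P \<union> X)" "P \<inter> X = {}" "3 dvd card (P \<union> X)"
  shows "3 dvd card X"
proof -
  have "card (P \<union> X) = card P + card X"
    using assms by (intro card_Un_disjoint) auto
  moreover have "3 dvd card P"
    using assms decomposable_3_dvd by auto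
  ultimately show ?thesis using assms(4) by (metis dvd_add_right_iff)
qed

section \<open>Explicit decompositions of small configurations\<close>

text \<open>Going round the triangle, each side becomes the middle edge of a path from
  \<open>a\<close> to \<open>b\<close>; every vertex is then joined once to each of them.\<close>

lemma decomposable_triangle:
  assumes "distinct [a, b, x, y, z]"
  shows "path4_decomposable ({{x, y}, {y, z}, {z, x}} \<union> spokes a b {x, y, z})"
proof -
  have "{{x, y}, {y, z}, {z, x}} \<union> spokes a b {x, y, z}
    = path4 a x y b \<union> (path4 a y z b \<union> path4 a z x b)"
    by (auto simp: path4_def insert_commute)
  also have "path4_decomposable \<dots>"
    using assms
    by (intro decomposable_Un decomposable_path4) (auto simp: path4_def doubleton_eq_iff)
  finally show ?thesis .
qed

text \<open>The 4-cycle \<open>x a y b\<close> is cut into two halves, and each half is extended by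
  one edge at \<open>c\<close>. The edges from \<open>c\<close> to \<open>a\<close> and
  \<open>b\<close> are left alone, so \<open>c\<close> stays with the remainder.\<close>

lemma decomposable_cherry:
  assumes "distinct [a, b, c, x, y]"
  shows "path4_decomposable ({{c, x}, {c, y}} \<union> spokes a b {x, y})"
proof -
  have "{{c, x}, {c, y}} \<union> spokes a b {x, y}
    = path4 c x a y \<union> path4 c y b x"
    by (auto simp: path4_def insert_commute)
  also have "path4_decomposable \<dots>"
    using assms
    by (intro decomposable_Un decomposable_path4) (auto simp: path4_def doubleton_eq_iff)
  finally show ?thesis .
qed

text \<open>For the situation where \<open>c\<close> would be the only vertex left after
  \<open>x\<close> and \<open>y\<close>: \<open>c\<close> and \<open>{a, b}\<close> are decomposed
  along with them, nine edges in all.\<close>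

lemma decomposable_cherry_hub:
  assumes "distinct [a, b, c, x, y]"
  shows "path4_decomposable ({{c, x}, {c, y}} \<union> spokes a b {c, x, y} \<union> {{a, b}})"
proof -
  have "{{c, x}, {c, y}} \<union> spokes a b {c, x, y} \<union> {{a, b}}
    = path4 x a b y \<union> (path4 a y c b \<union> path4 a c x b)"
    by (auto simp: path4_def insert_commute)
  also have "path4_decomposable \<dots>"
    using assms
    by (intro decomposable_Un decomposable_path4) (auto simp: path4_def doubleton_eq_iff)
  finally show ?thesis .
qed

text \<open>The six edges form the complete graph on four vertices, which is the union of two
  complementary paths.\<close>

lemma decomposable_edge_hub:
  assumes "distinct [a, b, x, y]"
  shows "path4_decomposable ({{x, y}} \<union> spokes a b {x, y} \<union> {{a, b}})"
proof -
  have "{{x, y}} \<union> spokes a b {x, y} \<union> {{a, b}}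
    = path4 a x y b \<union> path4 x b a y"
    by (auto simp: path4_def insert_commute)
  also have "path4_decomposable \<dots>"
    using assms
    by (intro decomposable_Un decomposable_path4) (auto simp: path4_def doubleton_eq_iff)
  finally show ?thesis .
qed

text \<open>For \<open>k\<close> isolated vertices the number \<open>2 * k + 1\<close> of edges is
  divisible by 3 first when \<open>k = 1\<close>, where the edges form a triangle, and next when
  \<open>k = 4\<close>.\<close>

lemma decomposable_four_hub:
  assumes "distinct [a, b, x, y, z, w]"
  shows "path4_decomposable (spokes a b {x, y, z, w} \<union> {{a, b}})"
proof -
  have "spokes a b {x, y, z, w} \<union> {{a, b}} = path4 x a b y \<union> (path4 y a z b \<union> path4 x b w a)"
    by (auto simp: path4_def insert_commute)
  also have "path4_decomposable \<dots>"
    using assms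
    by (intro decomposable_Un decomposable_path4) (auto simp: path4_def doubleton_eq_iff)
  finally show ?thesis .
qed

text \<open>For the situation where \<open>p\<close> is the only vertex outside the triangle; twelve
  edges, four paths.\<close>

lemma decomposable_triangle_isolated_hub:
  assumes "distinct [a, b, x, y, z, p]"
  shows "path4_decomposable ({{x, y}, {y, z}, {z, x}} \<union> spokes a b {x, y, z, p} \<union> {{a, b}})"
proof -
  have "{{x, y}, {y, z}, {z, x}} \<union> spokes a b {x, y, z, p} \<union> {{a, b}}
    = path4 a b x y \<union> (path4 a p b y \<union> (path4 a x z y \<union> path4 b z a y))"
    by (auto simp: path4_def insert_commute)
  also have "path4_decomposable \<dots>"
    using assms
    by (intro decomposable_Un decomposable_path4) (auto simp: path4_def doubleton_eq_iff)
  finally show ?thesis .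
qed

text \<open>A component of a matching is encoded as \<open>{x, y}\<close>, with \<open>x = y\<close> for an isolated vertex;
  its edge set is then \<open>{{x, y}} - {{x}}\<close> in both cases.\<close>

lemma decomposable_component_pendant:
  assumes "x \<notin> {a, b, v}" "y \<notin> {a, b, v}" "distinct [a, b, v]"
  shows "path4_decomposable ({{x, y}} - {{x}} \<union> spokes a b {x, y} \<union> {{v, a}})"
proof (cases "x = y")
  case True
  then have "{{x, y}} - {{x}} \<union> spokes a b {x, y} \<union> {{v, a}} = path4 v a x b"
    by (simp add: path4_def insert_commute)
  moreover have "distinct [v, a, x, b]"
    using assms by auto
  ultimately show ?thesis
    by (simp add: decomposable_path4)
next
  case False
  then have "{{x, y}} - {{x}} = {{x, y}}"
    by (auto simp: doubleton_eq_iff)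
  then have "{{x, y}} - {{x}} \<union> spokes a b {x, y} \<union> {{v, a}} = path4 y x a v \<union> path4 x b y a"
    by (auto simp: path4_def insert_commute)
  also have "path4_decomposable \<dots>"
    using assms False
    by (intro decomposable_Un decomposable_path4) (auto simp: path4_def doubleton_eq_iff)
  finally show ?thesis .
qed

text \<open>The third component is split: up to the path \<open>a x3 y3 b\<close> (if \<open>x3\<close> and \<open>y3\<close> differ) it consists
  of an edge at \<open>a\<close> and an edge at \<open>b\<close>, one for each of the other two components.\<close>

lemma decomposable_three_components:
  assumes "distinct [a, b]"
    and "{a, b} \<inter> ({x1, y1} \<union> {x2, y2} \<union> {x3, y3}) = {}"
    and "{x1, y1} \<inter> {x2, y2} = {}" "{x1, y1} \<inter> {x3, y3} = {}" "{x2, y2} \<inter> {x3, y3} = {}"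
  shows "path4_decomposable (({{x1, y1}} - {{x1}} \<union> spokes a b {x1, y1}) \<union>
    (({{x2, y2}} - {{x2}} \<union> spokes a b {x2, y2}) \<union> ({{x3, y3}} - {{x3}} \<union> spokes a b {x3, y3})))"
proof -
  let ?C1 = "{{x1, y1}} - {{x1}} \<union> spokes a b {x1, y1}"
  let ?C2 = "{{x2, y2}} - {{x2}} \<union> spokes a b {x2, y2}"
  let ?C3 = "{{x3, y3}} - {{x3}} \<union> spokes a b {x3, y3}"
  define R where "R = (if x3 = y3 then {} else path4 a x3 y3 b)"
  have C3: "?C3 = R \<union> ({{y3, a}} \<union> {{x3, b}})"
  proof (cases "x3 = y3")
    case False
    then have "{{x3, y3}} - {{x3}} = {{x3, y3}}"
      by (auto simp: doubleton_eq_iff)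
    then show ?thesis
      using False by (auto simp: R_def path4_def insert_commute)
  qed (simp add: R_def insert_commute)
  have R: "path4_decomposable R"
    using assms by (auto simp: R_def decomposable_empty intro!: decomposable_path4)
  have 1: "path4_decomposable (?C1 \<union> {{y3, a}})"
    using assms by (intro decomposable_component_pendant) auto
  \<comment> \<open>The spare edge is at \<open>b\<close>, so the previous lemma is applied with
    \<open>a\<close> and \<open>b\<close> exchanged.\<close>
  have "path4_decomposable ({{x2, y2}} - {{x2}} \<union> spokes b a {x2, y2} \<union> {{x3, b}})"
    using assms by (intro decomposable_component_pendant) auto
  then have 2: "path4_decomposable (?C2 \<union> {{x3, b}})"
    by (simp add: spokes_commute)
  have "{{y3, a}} \<inter> (R \<union> {{x3, b}}) = {}" "R \<inter> {{x3, b}} = {}"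
    using assms by (auto simp: R_def path4_def doubleton_eq_iff)
  moreover have "?C1 \<inter> ?C2 = {}" "?C1 \<inter> ?C3 = {}" "?C2 \<inter> ?C3 = {}"
    using assms by (simp_all, blast+)
  \<comment> \<open>The spare edges \<open>P\<close> and \<open>Q\<close> are handed to
    \<open>C1\<close> and \<open>C2\<close>; generic sets keep this regrouping free of the shape of
    the components.\<close>
  moreover have "path4_decomposable (C1 \<union> (C2 \<union> (R \<union> (P \<union> Q))))"
    if "path4_decomposable (C1 \<union> P)" "path4_decomposable (C2 \<union> Q)" "P \<inter> (R \<union> Q) = {}" "R \<inter> Q = {}"
      "C1 \<inter> C2 = {}" "C1 \<inter> (R \<union> (P \<union> Q)) = {}" "C2 \<inter> (R \<union> (P \<union> Q)) = {}" for C1 C2 P Q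
  proof -
    have "path4_decomposable ((C1 \<union> P) \<union> ((C2 \<union> Q) \<union> R))"
    proof (rule decomposable_Un[OF that(1) decomposable_Un[OF that(2) R]])
      show "(C2 \<union> Q) \<inter> R = {}"
        using that by (simp add: Int_Un_distrib Int_Un_distrib2 Int_commute)
      show "(C1 \<union> P) \<inter> ((C2 \<union> Q) \<union> R) = {}"
        using that by (simp add: Int_Un_distrib Int_Un_distrib2 Int_commute)
    qed
    also have "(C1 \<union> P) \<union> ((C2 \<union> Q) \<union> R) = C1 \<union> (C2 \<union> (R \<union> (P \<union> Q)))"
      by blast
    finally show ?thesis .
  qed
  ultimately show ?thesis
    using 1 2 unfolding C3 by metis
qed

section \<open>Deleting vertices together with their edges\<close>

text \<open>What remains is again an edge set on a vertex set together with all its spokes, so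
  removing vertices fits an induction.\<close>

lemma remove_vertices_eq:
  assumes "S \<subseteq> V"
  shows "E \<union> spokes a b V = (incident E S \<union> spokes a b S) \<union> ((E - incident E S) \<union> spokes a b (V - S))"
proof -
  have "spokes a b V = spokes a b S \<union> spokes a b (V - S)"
    using assms by (metis Un_Diff_cancel2 Un_commute spokes_Un sup.absorb1)
  then show ?thesis by (auto simp: incident_def)
qed

lemma remove_vertices_pairs:
  assumes "E \<subseteq> pairs V"
  shows "E - incident E S \<subseteq> pairs (V - S)"
  using assms by (auto simp: incident_def pairs_def)

lemma remove_vertices_disjoint:
  assumes "S \<subseteq> V" "E \<subseteq> pairs V" "a \<notin> V" "b \<notin> V"
  shows "(incident E S \<union> spokes a b S) \<inter> ((E - incident E S) \<union> spokes a b (V - S)) = {}"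
proof -
  have "incident E S \<subseteq> pairs V" "E - incident E S \<subseteq> pairs V"
    using assms(2) by (auto simp: incident_def)
  moreover have "pairs V \<inter> spokes a b W = {}" for W
    using assms by (intro pairs_Int_spokes)
  moreover have "spokes a b S \<inter> spokes a b (V - S) = {}"
    using assms by (auto simp: spokes_def doubleton_eq_iff)
  ultimately show ?thesis by fast
qed

lemma hub_notin: "a \<notin> V \<Longrightarrow> b \<notin> V \<Longrightarrow> E \<subseteq> pairs V \<Longrightarrow> {a, b} \<notin> E \<union> spokes a b V"
  by (auto simp: pairs_def spokes_def doubleton_eq_iff)

lemma incident_eqI:
  assumes "F \<subseteq> E" "\<And>e. e \<in> E \<Longrightarrow> e \<inter> S \<noteq> {} \<Longrightarrow> e \<in> F" "\<And>e. e \<in> F \<Longrightarrow> e \<inter> S \<noteq> {}"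
  shows "incident E S = F"
  using assms unfolding incident_def by blast

lemma incident_disjoint:
  assumes "disjoint E" "e \<in> E" "e \<noteq> {}"
  shows "incident E e = {e}"
  using assms by (intro incident_eqI) (auto dest: disjointD)

lemma Int_Un_singleton_empty:
  "X \<inter> Y = {} \<Longrightarrow> h \<notin> X \<Longrightarrow> X \<inter> (Y \<union> {h}) = {}"
  by blast

section \<open>Matchings without the edge between the special vertices\<close>

text \<open>The vertex \<open>y\<close> is the partner of \<open>x\<close> in the matching, or
  \<open>x\<close> itself if no edge of \<open>E\<close> contains \<open>x\<close>; the equation
  covers both.\<close>

lemma obtain_component:
  assumes "E \<subseteq> pairs V" "disjoint E" "x \<in> V"
  obtains y where "y \<in> V" "incident E {x, y} = {{x, y}} - {{x}}"
proof (cases "\<exists>e\<in>E. x \<in> e")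
  case True
  then obtain y where y: "{x, y} \<in> E" "x \<noteq> y" "y \<in> V"
    using assms(1) pairs_obtain_other_end by (metis subsetD)
  have "incident E {x, y} = {{x, y}}"
    using assms(2) y(1) by (rule incident_disjoint) simp
  also have "\<dots> = {{x, y}} - {{x}}"
    using y by (auto simp: doubleton_eq_iff)
  finally show ?thesis by (intro that[OF y(3)])
next
  case False
  then have "incident E {x, x} = {{x, x}} - {{x}}"
    by (auto simp: incident_def)
  then show ?thesis by (intro that[OF assms(3)])
qed

text \<open>Two edges for an isolated vertex, five for an edge. The common residue is why components
  can be grouped in threes whatever their kinds.\<close>

lemma card_component_mod_3:
  assumes "x \<notin> {a, b}" "y \<notin> {a, b}" "a \<noteq> b"
  shows "card ({{x, y}} - {{x}} \<union> spokes a b {x, y}) mod 3 = 2"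
proof (cases "x = y")
  case True
  then show ?thesis using assms by (simp add: doubleton_eq_iff)
next
  case False
  then have "{{x, y}} - {{x}} = {{x, y}}"
    by (auto simp: doubleton_eq_iff)
  moreover have "card ({{x, y}} \<union> spokes a b {x, y}) = 5"
    using assms False by (auto simp: doubleton_eq_iff)
  ultimately show ?thesis by simp
qed

text \<open>One step of splitting a matching into components, recorded with the residue of the
  number of edges; it is applied three times in a row below.\<close>

lemma peel_component:
  assumes "finite V" "E \<subseteq> pairs V" "disjoint E" "a \<notin> V" "b \<notin> V" "a \<noteq> b" "V \<noteq> {}"
  obtains x y C E' where "x \<in> V" "y \<in> V" "C = {{x, y}} - {{x}} \<union> spokes a b {x, y}"
    "E' \<subseteq> pairs (V - {x, y})" "disjoint E'"
    "E \<union> spokes a b V = C \<union> (E' \<union> spokes a b (V - {x, y}))"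
    "C \<inter> (E' \<union> spokes a b (V - {x, y})) = {}"
    "card (E \<union> spokes a b V) mod 3 = (2 + card (E' \<union> spokes a b (V - {x, y}))) mod 3"
proof -
  obtain x where x: "x \<in> V" using assms(7) by blast
  obtain y where y: "y \<in> V" and inc: "incident E {x, y} = {{x, y}} - {{x}}"
    using obtain_component[OF assms(2,3) x] .
  have S: "{x, y} \<subseteq> V" using x y by simp
  define C where "C = {{x, y}} - {{x}} \<union> spokes a b {x, y}"
  define E' where "E' = E - incident E {x, y}"
  let ?R = "E' \<union> spokes a b (V - {x, y})"
  have eq: "E \<union> spokes a b V = C \<union> ?R"
    using remove_vertices_eq[OF S, of E a b] by (simp only: inc C_def E'_def)
  have disj: "C \<inter> ?R = {}"
    using remove_vertices_disjoint[OF S assms(2,4,5)] by (simp only: inc C_def E'_def)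
  have "finite (E \<union> spokes a b V)"
    using assms(1,2) finite_subset[OF _ finite_pairs] by (simp add: finite_spokes)
  then have "card (E \<union> spokes a b V) = card C + card ?R"
    unfolding eq using disj by (intro card_Un_disjoint) auto
  moreover have "card C mod 3 = 2"
    unfolding C_def using x y assms(4-6) by (intro card_component_mod_3) auto
  ultimately have card: "card (E \<union> spokes a b V) mod 3 = (2 + card ?R) mod 3"
    by (metis mod_add_left_eq)
  have "E' \<subseteq> pairs (V - {x, y})" "disjoint E'"
    using remove_vertices_pairs[OF assms(2)] assms(3) by (auto simp: E'_def pairwise_def)
  then show ?thesis
    using that[OF x y C_def _ _ eq disj card] by blast
qed

text \<open>With \<open>k\<close> components the number of edges is \<open>2 * k\<close> modulo 3,
  so \<open>k\<close> is a multiple of 3. Strong induction takes out three components at a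
  time.\<close>

lemma decomposable_matching:
  assumes "finite V" "E \<subseteq> pairs V" "disjoint E" "a \<notin> V" "b \<notin> V" "a \<noteq> b"
    and "3 dvd card (E \<union> spokes a b V)"
  shows "path4_decomposable (E \<union> spokes a b V)"
  using assms
proof (induction V arbitrary: E rule: finite_psubset_induct)
  case (psubset V)
  note prems = psubset.prems
  show ?case
  proof (cases "V = {}")
    case True
    then show ?thesis using prems(1) by (simp add: decomposable_empty)
  next
    case False
    obtain x1 y1 C1 E1 where 1: "x1 \<in> V" "y1 \<in> V" "C1 = {{x1, y1}} - {{x1}} \<union> spokes a b {x1, y1}"
      "E1 \<subseteq> pairs (V - {x1, y1})" "disjoint E1"
      and eq1: "E \<union> spokes a b V = C1 \<union> (E1 \<union> spokes a b (V - {x1, y1}))"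
      and disj1: "C1 \<inter> (E1 \<union> spokes a b (V - {x1, y1})) = {}"
      and card1: "card (E \<union> spokes a b V) mod 3 = (2 + card (E1 \<union> spokes a b (V - {x1, y1}))) mod 3"
      using peel_component[OF \<open>finite V\<close> prems(1-5) False] by metis
    define V1 where "V1 = V - {x1, y1}"
    note 1 = 1[folded V1_def] and eq1 = eq1[folded V1_def] and disj1 = disj1[folded V1_def]
      and card1 = card1[folded V1_def]
    have V1: "finite V1" "a \<notin> V1" "b \<notin> V1"
      using \<open>finite V\<close> prems by (auto simp: V1_def)
    \<comment> \<open>A single component has residue 2.\<close>
    have "V1 \<noteq> {}"
    proof
      assume "V1 = {}"
      then have "card (E1 \<union> spokes a b V1) = 0"
        using 1(4) by simp
      then show False using card1 prems(6) by (simp add: dvd_eq_mod_eq_0)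
    qed
    obtain x2 y2 C2 E2 where 2: "x2 \<in> V1" "y2 \<in> V1" "C2 = {{x2, y2}} - {{x2}} \<union> spokes a b {x2, y2}"
      "E2 \<subseteq> pairs (V1 - {x2, y2})" "disjoint E2"
      and eq2: "E1 \<union> spokes a b V1 = C2 \<union> (E2 \<union> spokes a b (V1 - {x2, y2}))"
      and disj2: "C2 \<inter> (E2 \<union> spokes a b (V1 - {x2, y2})) = {}"
      and card2: "card (E1 \<union> spokes a b V1) mod 3 = (2 + card (E2 \<union> spokes a b (V1 - {x2, y2}))) mod 3"
      using peel_component[OF V1(1) 1(4,5) V1(2,3) prems(5) \<open>V1 \<noteq> {}\<close>] by metis
    define V2 where "V2 = V1 - {x2, y2}"
    note 2 = 2[folded V2_def] and eq2 = eq2[folded V2_def] and disj2 = disj2[folded V2_def]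
      and card2 = card2[folded V2_def]
    have V2: "finite V2" "a \<notin> V2" "b \<notin> V2"
      using V1 by (auto simp: V2_def)
    have card12: "card (E \<union> spokes a b V) mod 3 = (2 + (2 + card (E2 \<union> spokes a b V2))) mod 3"
      using card1 card2 by (metis mod_add_right_eq)
    \<comment> \<open>Two components have residue 1.\<close>
    have "V2 \<noteq> {}"
    proof
      assume "V2 = {}"
      then have "card (E2 \<union> spokes a b V2) = 0"
        using 2(4) by simp
      then show False using card12 prems(6) by (simp add: dvd_eq_mod_eq_0)
    qed
    obtain x3 y3 C3 E3 where 3: "x3 \<in> V2" "y3 \<in> V2" "C3 = {{x3, y3}} - {{x3}} \<union> spokes a b {x3, y3}"
      "E3 \<subseteq> pairs (V2 - {x3, y3})" "disjoint E3"
      and eq3: "E2 \<union> spokes a b V2 = C3 \<union> (E3 \<union> spokes a b (V2 - {x3, y3}))"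
      and disj3: "C3 \<inter> (E3 \<union> spokes a b (V2 - {x3, y3})) = {}"
      and card3: "card (E2 \<union> spokes a b V2) mod 3 = (2 + card (E3 \<union> spokes a b (V2 - {x3, y3}))) mod 3"
      using peel_component[OF V2(1) 2(4,5) V2(2,3) prems(5) \<open>V2 \<noteq> {}\<close>] by metis
    define V3 where "V3 = V2 - {x3, y3}"
    note 3 = 3[folded V3_def] and eq3 = eq3[folded V3_def] and disj3 = disj3[folded V3_def]
      and card3 = card3[folded V3_def]
    have "V3 \<subset> V" "a \<notin> V3" "b \<notin> V3"
      using 1 V2 by (auto simp: V1_def V2_def V3_def)
    moreover have "3 dvd card (E3 \<union> spokes a b V3)"
    proof -
      have "card (E \<union> spokes a b V) mod 3 = (2 + (2 + (2 + card (E3 \<union> spokes a b V3)))) mod 3"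
        using card12 card3 by (metis mod_add_right_eq)
      also have "\<dots> = card (E3 \<union> spokes a b V3) mod 3"
        by presburger
      finally show ?thesis
        using prems(6) by (simp only: dvd_eq_mod_eq_0)
    qed
    ultimately have R: "path4_decomposable (E3 \<union> spokes a b V3)"
      using 3(4,5) prems(5) by (intro psubset.IH)
    have "{a, b} \<inter> ({x1, y1} \<union> {x2, y2} \<union> {x3, y3}) = {}"
      "{x1, y1} \<inter> {x2, y2} = {}" "{x1, y1} \<inter> {x3, y3} = {}" "{x2, y2} \<inter> {x3, y3} = {}"
      using 1(1,2) 2(1,2) 3(1,2) prems(3,4) by (auto simp: V1_def V2_def)
    then have C: "path4_decomposable (C1 \<union> (C2 \<union> C3))"
      using prems(5) unfolding 1(3) 2(3) 3(3) by (intro decomposable_three_components) auto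
    have "(C1 \<union> (C2 \<union> C3)) \<inter> (E3 \<union> spokes a b V3) = {}"
      using disj1 disj2 disj3 unfolding eq2 eq3 by blast
    then have "path4_decomposable ((C1 \<union> (C2 \<union> C3)) \<union> (E3 \<union> spokes a b V3))"
      by (rule decomposable_Un[OF C R])
    then show ?thesis
      unfolding eq1 eq2 eq3 by (simp only: Un_assoc)
  qed
qed

section \<open>The edge between the special vertices, and the greedy induction\<close>

text \<open>Keeps \<open>{a, b}\<close> with the remainder, so that the reduced graph has the same
  form as the original one.\<close>

lemma decomposable_remove:
  assumes "S \<subseteq> V" "E \<subseteq> pairs V" "a \<notin> V" "b \<notin> V"
    and "path4_decomposable (incident E S \<union> spokes a b S)"
    and "path4_decomposable ((E - incident E S) \<union> spokes a b (V - S) \<union> {{a, b}})"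
  shows "path4_decomposable (E \<union> spokes a b V \<union> {{a, b}})"
proof -
  note eq = remove_vertices_eq[OF assms(1), of E a b]
  have "{a, b} \<notin> incident E S \<union> spokes a b S"
    using hub_notin[OF assms(3,4,2)] unfolding eq by (rule contra_subsetD[OF Un_upper1])
  then have "path4_decomposable ((incident E S \<union> spokes a b S) \<union>
      ((E - incident E S) \<union> spokes a b (V - S) \<union> {{a, b}}))"
    by (intro decomposable_Un assms(5,6) Int_Un_singleton_empty remove_vertices_disjoint assms(1-4))
  then show ?thesis by (simp only: eq Un_assoc)
qed

text \<open>A set \<open>S\<close> that absorbs \<open>{a, b}\<close>, one edge or four isolated
  vertices, is taken out first; \<open>decomposable_matching\<close> handles the rest.\<close>

lemma decomposable_matching_hub:
  assumes "finite V" "E \<subseteq> pairs V" "disjoint E" "a \<notin> V" "b \<notin> V" "a \<noteq> b" "2 \<le> card V"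
    and "3 dvd card (E \<union> spokes a b V \<union> {{a, b}})"
  shows "path4_decomposable (E \<union> spokes a b V \<union> {{a, b}})"
proof -
  have fin: "finite (E \<union> spokes a b V \<union> {{a, b}})"
    using assms(1,2) finite_subset[OF _ finite_pairs] by (simp add: finite_spokes)
  obtain S where S: "S \<subseteq> V" and dS: "path4_decomposable (incident E S \<union> spokes a b S \<union> {{a, b}})"
  proof (cases "E = {}")
    case True
    have "card (E \<union> spokes a b V \<union> {{a, b}}) = Suc (2 * card V)"
      using True hub_notin[of a V b "{}"] assms
      by (simp add: card_spokes finite_spokes)
    \<comment> \<open>\<open>2 * card V + 1\<close> is divisible by 3 only if \<open>card V\<close>
      is 1 modulo 3, and the value 1 is excluded.\<close>
    then have "4 \<le> card V"
      using assms(7,8) by presburger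
    then obtain S where S: "S \<subseteq> V" "card S = 4"
      using obtain_subset_with_card_n by metis
    then obtain x y z w where "S = {x, y, z, w}" "distinct [x, y, z, w]"
      by (auto simp: card_Suc_eq numeral_eq_Suc)
    then have "path4_decomposable (spokes a b S \<union> {{a, b}})"
      using S(1) assms by (simp only:) (intro decomposable_four_hub, auto)
    then show ?thesis
      using that[OF S(1)] True by (simp add: incident_def)
  next
    case False
    then obtain e where "e \<in> E" by blast
    then obtain x y where xy: "{x, y} \<in> E" "x \<noteq> y" "x \<in> V" "y \<in> V"
      using assms(2) pairs_iff[of e V] by blast
    have "incident E {x, y} = {{x, y}}"
      using assms(3) xy(1) by (rule incident_disjoint) simp
    moreover have "path4_decomposable ({{x, y}} \<union> spokes a b {x, y} \<union> {{a, b}})"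
      using xy assms by (intro decomposable_edge_hub) auto
    ultimately show ?thesis
      using that[of "{x, y}"] xy by simp
  qed
  let ?H = "incident E S \<union> spokes a b S \<union> {{a, b}}"
  let ?R = "(E - incident E S) \<union> spokes a b (V - S)"
  note eq = remove_vertices_eq[OF S, of E a b]
  have eq': "E \<union> spokes a b V \<union> {{a, b}} = ?H \<union> ?R"
    unfolding eq by blast
  have disj: "?H \<inter> ?R = {}"
  proof -
    have "{a, b} \<notin> ?R"
      using hub_notin[OF assms(4,5,2)] unfolding eq by (rule contra_subsetD[OF Un_upper2])
    then have "?R \<inter> ((incident E S \<union> spokes a b S) \<union> {{a, b}}) = {}"
      using remove_vertices_disjoint[OF S assms(2,4,5)]
      by (intro Int_Un_singleton_empty) (simp only: Int_commute)
    then show ?thesis by (simp only: Int_commute)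
  qed
  have "3 dvd card ?R"
    using fin assms(8) unfolding eq' by (rule dvd_card_remove[OF dS _ disj])
  moreover have "disjoint (E - incident E S)"
    using assms(3) by (simp add: pairwise_def)
  ultimately have "path4_decomposable ?R"
    using assms remove_vertices_pairs[OF assms(2)] by (intro decomposable_matching) auto
  then show ?thesis
    unfolding eq' by (rule decomposable_Un[OF dS _ disj])
qed

text \<open>Induction on \<open>card V + card E\<close>: taking out a path shrinks \<open>E\<close>,
  taking out a triangle or two leaves shrinks \<open>V\<close>. The bound
  \<open>2 \<le> card V\<close> must survive every step, which creates the small cases treated
  separately.\<close>

lemma decomposable_hub:
  assumes "finite V" "E \<subseteq> pairs V" "a \<notin> V" "b \<notin> V" "a \<noteq> b" "2 \<le> card V"
    and "3 dvd card (E \<union> spokes a b V \<union> {{a, b}})"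
  shows "path4_decomposable (E \<union> spokes a b V \<union> {{a, b}})"
  using assms
proof (induction "card V + card E" arbitrary: V E rule: less_induct)
  case less
  note prems = less.prems
  have finE: "finite E"
    using prems finite_subset[OF _ finite_pairs] by blast
  have fin: "finite (E \<union> spokes a b V \<union> {{a, b}})"
    by (simp add: finE finite_spokes prems(1))
  have card_total: "card (E \<union> spokes a b V \<union> {{a, b}}) = card E + 2 * card V + 1"
  proof -
    have "E \<inter> spokes a b V = {}"
      using pairs_Int_spokes[OF prems(3,4)] prems(2) by blast
    then show ?thesis
      using hub_notin[of a V b E] prems finE
      by (simp add: card_Un_disjoint card_spokes finite_spokes)
  qed
  \<comment> \<open>Common reduction for triangles and pairs of leaves; two vertices must remain for
    the induction hypothesis to apply.\<close>
  have remove: ?case if S: "S \<subseteq> V" "S \<noteq> {}" "2 \<le> card (V - S)"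
    and dS: "path4_decomposable (incident E S \<union> spokes a b S)" for S
  proof -
    let ?R = "(E - incident E S) \<union> spokes a b (V - S) \<union> {{a, b}}"
    note eq = remove_vertices_eq[OF S(1), of E a b]
    have eq': "E \<union> spokes a b V \<union> {{a, b}} = (incident E S \<union> spokes a b S) \<union> ?R"
      unfolding eq by blast
    have "{a, b} \<notin> incident E S \<union> spokes a b S"
      using hub_notin[OF prems(3,4,2)] unfolding eq by (rule contra_subsetD[OF Un_upper1])
    then have disj: "(incident E S \<union> spokes a b S) \<inter> ?R = {}"
      by (intro Int_Un_singleton_empty remove_vertices_disjoint S(1) prems(2-4))
    have "3 dvd card ?R"
      using fin prems(7) unfolding eq' by (rule dvd_card_remove[OF dS _ disj])
    moreover have "card (V - S) < card V"
      using S prems(1) by (intro psubset_card_mono) auto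
    moreover have "card (E - incident E S) \<le> card E"
      using finE by (intro card_mono) auto
    ultimately have "path4_decomposable ?R"
      using prems S remove_vertices_pairs[OF prems(2)] by (intro less.hyps) auto
    then show ?thesis
      by (rule decomposable_remove[OF S(1) prems(2-4) dS])
  qed
  \<comment> \<open>The triangle and cherry cases carry the failure of the earlier ones, which makes
    the triangle a component and \<open>x\<close>, \<open>y\<close> leaves. In the last case no two
    distinct edges share a vertex.\<close>
  consider (path) x y z w where "distinct [x, y, z, w]" "path4 x y z w \<subseteq> E"
    | (triangle) x y z where "\<nexists>x y z w. distinct [x, y, z, w] \<and> path4 x y z w \<subseteq> E"
      "distinct [x, y, z]" "{x, y} \<in> E" "{y, z} \<in> E" "{z, x} \<in> E"
    | (cherry) c x y where "\<nexists>x y z w. distinct [x, y, z, w] \<and> path4 x y z w \<subseteq> E"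
      "\<nexists>x y z. distinct [x, y, z] \<and> {x, y} \<in> E \<and> {y, z} \<in> E \<and> {z, x} \<in> E"
      "distinct [c, x, y]" "{c, x} \<in> E" "{c, y} \<in> E"
    | (matching) "\<nexists>c x y. distinct [c, x, y] \<and> {c, x} \<in> E \<and> {c, y} \<in> E"
    by metis
  then show ?case
  proof cases
    case path
    let ?P = "path4 x y z w"
    have dP: "path4_decomposable ?P"
      using path by (simp add: decomposable_path4)
    have eq: "E \<union> spokes a b V \<union> {{a, b}} = ?P \<union> ((E - ?P) \<union> spokes a b V \<union> {{a, b}})"
      using path by blast
    have disj: "?P \<inter> ((E - ?P) \<union> spokes a b V \<union> {{a, b}}) = {}"
      using path(2) pairs_Int_spokes[OF prems(3,4), of V] hub_notin[OF prems(3,4,2)] prems(2) by blast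
    have "3 dvd card ((E - ?P) \<union> spokes a b V \<union> {{a, b}})"
      using fin prems(7) unfolding eq by (rule dvd_card_remove[OF dP _ disj])
    moreover have "card (E - ?P) < card E"
      using path finE by (intro psubset_card_mono) (auto simp: path4_def)
    ultimately have "path4_decomposable ((E - ?P) \<union> spokes a b V \<union> {{a, b}})"
      using prems by (intro less.hyps) auto
    then show ?thesis
      unfolding eq by (rule decomposable_Un[OF dP _ disj])
  next
    case triangle
    have V: "x \<in> V" "y \<in> V" "z \<in> V"
      using triangle(3-5) prems(2) by (auto simp: pairs_def)
    \<comment> \<open>A further edge at \<open>p\<close> would give the path \<open>t p q r\<close>.
      Used for the three rotations of the triangle.\<close>
    have closed: "t \<in> {p, q, r}" if "distinct [p, q, r]" "{p, q} \<in> E" "{q, r} \<in> E" "{p, t} \<in> E" "t \<noteq> p" for p q r t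
    proof (rule ccontr)
      assume "t \<notin> {p, q, r}"
      then have "distinct [t, p, q, r]" "path4 t p q r \<subseteq> E"
        using that by (auto simp: path4_def insert_commute)
      then show False using triangle(1) by blast
    qed
    have "e \<in> {{x, y}, {y, z}, {z, x}}" if e_in: "e \<in> E" "e \<inter> {x, y, z} \<noteq> {}" for e
    proof -
      obtain s where s: "s \<in> e" "s \<in> {x, y, z}"
        using e_in by blast
      obtain t where e: "e = {s, t}" "s \<noteq> t"
        using pairs_obtain_other_end[of e V s] e_in(1) prems(2) s(1) by blast
      have st: "{s, t} \<in> E" "t \<noteq> s"
        using e e_in(1) by simp_all
      have "t \<in> {x, y, z}" if "s = x"
        using closed[OF triangle(2,3,4), of t] st that by simp
      moreover have "t \<in> {y, z, x}" if "s = y"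
        using closed[of y z x t] triangle(2,4,5) st that by auto
      moreover have "t \<in> {z, x, y}" if "s = z"
        using closed[of z x y t] triangle(2,3,5) st that by auto
      ultimately have "t \<in> {x, y, z}"
        using s(2) by blast
      then show ?thesis using s(2) e by (auto simp: insert_commute)
    qed
    then have inc: "incident E {x, y, z} = {{x, y}, {y, z}, {z, x}}"
      using triangle(3-5) by (intro incident_eqI) auto
    have dS: "path4_decomposable (incident E {x, y, z} \<union> spokes a b {x, y, z})"
      unfolding inc using triangle(2) V prems by (intro decomposable_triangle) auto
    show ?thesis
    proof (cases "2 \<le> card (V - {x, y, z})")
      case True
      then show ?thesis using remove[of "{x, y, z}"] V dS by blast
    next
      case False
      have card_tri: "card {{x, y}, {y, z}, {z, x}} = 3"
        using triangle(2) by (auto simp: doubleton_eq_iff)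
      have "pairs (V - {x, y, z}) = {}"
        using False prems(1) by (intro pairs_eq_empty) auto
      then have "E \<subseteq> incident E {x, y, z}"
        using remove_vertices_pairs[OF prems(2), of "{x, y, z}"] by blast
      then have E: "E = {{x, y}, {y, z}, {z, x}}"
        unfolding inc using triangle(3-5) by (intro subset_antisym) simp_all
      have "card {x, y, z} = 3" "{x, y, z} \<subseteq> V"
        using triangle(2) V by auto
      then have "card V = card (V - {x, y, z}) + 3"
        using card_Diff_subset[of "{x, y, z}" V] card_mono[OF prems(1), of "{x, y, z}"] by simp
      moreover have "3 dvd 3 + 2 * card V + 1"
        using prems(7) card_total card_tri E by metis
      \<comment> \<open>Three vertices alone would give \<open>3 + 6 + 1 = 10\<close> edges.\<close>
      ultimately have "card (V - {x, y, z}) \<noteq> 0"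
        by presburger
      then have "card (V - {x, y, z}) = 1"
        using False by linarith
      then obtain p where "V - {x, y, z} = {p}"
        using card_1_singletonE by blast
      then have "p \<notin> {x, y, z}" "V = {x, y, z, p}"
        using V by blast+
      then show ?thesis
        unfolding E using prems(3-5) triangle(2)
        by (simp only:) (intro decomposable_triangle_isolated_hub, auto)
    qed
  next
    case cherry
    have V: "c \<in> V" "x \<in> V" "y \<in> V"
      using cherry(4,5) prems(2) by (auto simp: pairs_def)
    \<comment> \<open>A further neighbour \<open>t\<close> of \<open>p\<close> closes a triangle if
      \<open>t = q\<close> and otherwise starts the path \<open>t p c q\<close>.\<close>
    have leaf: "t = c" if "distinct [c, p, q]" "{c, p} \<in> E" "{c, q} \<in> E" "{p, t} \<in> E" "t \<noteq> p" for p q t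
    proof (rule ccontr)
      assume "t \<noteq> c"
      have "t \<noteq> q"
      proof
        assume "t = q"
        then have "{p, q} \<in> E" "{q, c} \<in> E"
          using that by (auto simp: insert_commute)
        then show False using that cherry(2) by blast
      qed
      then have "distinct [t, p, c, q]" "path4 t p c q \<subseteq> E"
        using that \<open>t \<noteq> c\<close> by (auto simp: path4_def insert_commute)
      then show False using cherry(1) by blast
    qed
    have "e \<in> {{c, x}, {c, y}}" if e_in: "e \<in> E" "e \<inter> {x, y} \<noteq> {}" for e
    proof -
      obtain s where s: "s \<in> e" "s \<in> {x, y}"
        using e_in by blast
      obtain t where e: "e = {s, t}" "s \<noteq> t"
        using pairs_obtain_other_end[of e V s] e_in(1) prems(2) s(1) by blast
      have st: "{s, t} \<in> E" "t \<noteq> s"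
        using e e_in(1) by simp_all
      have "t = c" if "s = x"
        using leaf[OF cherry(3-5), of t] st that by simp
      moreover have "t = c" if "s = y"
        using leaf[of y x t] cherry(3-5) st that by auto
      ultimately have "t = c"
        using s(2) by blast
      then show ?thesis using s(2) e by (auto simp: insert_commute)
    qed
    then have inc: "incident E {x, y} = {{c, x}, {c, y}}"
      using cherry(4,5) by (intro incident_eqI) auto
    have dS: "path4_decomposable (incident E {x, y} \<union> spokes a b {x, y})"
      unfolding inc using cherry(3) V prems by (intro decomposable_cherry) auto
    show ?thesis
    proof (cases "2 \<le> card (V - {x, y})")
      case True
      then show ?thesis using remove[of "{x, y}"] V dS by blast
    next
      case False
      \<comment> \<open>The centre \<open>c\<close> lies outside \<open>{x, y}\<close>, and fewer
        than two vertices do.\<close>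
      have "V - {x, y} = {c}"
      proof (rule ccontr)
        assume "V - {x, y} \<noteq> {c}"
        then obtain d where "d \<in> V - {x, y}" "d \<noteq> c"
          using V cherry(3) by auto
        then have "card {c, d} \<le> card (V - {x, y})"
          using V cherry(3) prems(1) by (intro card_mono) auto
        then show False using False \<open>d \<noteq> c\<close> by simp
      qed
      then have Veq: "V = {c, x, y}"
        using V by auto
      have "e \<inter> {x, y} \<noteq> {}" if "e \<in> E" for e
        using that prems(2) pairs_iff[of e V] unfolding Veq by blast
      then have "E \<subseteq> incident E {x, y}"
        by (auto simp: incident_def)
      then have E: "E = {{c, x}, {c, y}}"
        unfolding inc using cherry(4,5) by blast
      show ?thesis
        unfolding E Veq using cherry(3) V prems by (intro decomposable_cherry_hub) auto
    qed
  next
    case matching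
    have "e = f" if ef: "e \<in> E" "f \<in> E" "e \<inter> f \<noteq> {}" for e f
    proof -
      obtain c where "c \<in> e" "c \<in> f" using ef by blast
      then obtain x y where "e = {c, x}" "f = {c, y}" "c \<noteq> x" "c \<noteq> y"
        using ef(1,2) prems(2) pairs_obtain_other_end by (metis subsetD)
      then show ?thesis
        using matching ef by auto
    qed
    then have "disjoint E"
      by (auto simp: pairwise_def disjnt_def)
    then show ?thesis
      using prems by (intro decomposable_matching_hub)
  qed
qed

section \<open>Paths as graphs, and their transport along isomorphisms\<close>

text \<open>A path has no isolated vertex, so the covered vertices are exactly its vertices and the
  edge set determines the graph.\<close>

definition graph_of :: "'a set set \<Rightarrow> 'a graph" where
  "graph_of E = Graph (\<Union>E) E"

lemma edges_graph_of [simp]: "edges (graph_of E) = E"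
  by (simp add: graph_of_def)

lemma edges_complete_graph: "edges (complete_graph V) = pairs V"
  by (simp add: complete_graph_def pairs_def)

lemma simple_complete_graph: "finite V \<Longrightarrow> simple_graph (complete_graph V)"
  by (simp add: complete_graph_def simple_graph_def)

lemma path4_subset_pairs: "distinct [x, y, z, w] \<Longrightarrow> path4 x y z w \<subseteq> pairs {x, y, z, w}"
  by (simp add: path4_def pairs_def)

lemma simple_graph_of_path4:
  assumes "is_path4 P"
  shows "simple_graph (graph_of P)"
proof -
  obtain x y z w where P: "distinct [x, y, z, w]" "P = path4 x y z w"
    using assms unfolding is_path4_def by blast
  have "\<Union>P = {x, y, z, w}"
    using P by (auto simp: path4_def)
  then show ?thesis
    using path4_subset_pairs[OF P(1)] P(2)
    by (auto simp: simple_graph_def graph_of_def pairs_def)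
qed

lemma graph_iso_graph_of_path4:
  assumes "is_path4 P"
  shows "graph_iso (graph_of P) P4"
proof -
  obtain x y z w where d: "distinct [x, y, z, w]" and P: "P = path4 x y z w"
    using assms unfolding is_path4_def by blast
  have V: "\<Union>P = {x, y, z, w}"
    unfolding P path4_def by auto
  \<comment> \<open>Everything other than \<open>x\<close>, \<open>y\<close>, \<open>z\<close> is
    sent to 3, but among these only \<open>w\<close> lies on the path.\<close>
  define \<phi> where "\<phi> = (\<lambda>u. if u = x then 0 else if u = y then 1 else if u = z then 2 else 3 :: nat)"
  have \<phi>: "\<phi> x = 0" "\<phi> y = 1" "\<phi> z = 2" "\<phi> w = 3"
    using d by (auto simp: \<phi>_def)
  have "inj_on \<phi> {x, y, z, w}"
    by (auto simp: inj_on_def \<phi>)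
  then have "bij_betw \<phi> {x, y, z, w} {0, 1, 2, 3}"
    unfolding bij_betw_def by (simp add: \<phi>)
  moreover have "{{0, 1}, {1, 2}, {2, 3}} = (\<lambda>e. \<phi> ` e) ` P"
    by (simp add: P path4_def \<phi>)
  ultimately show ?thesis
    unfolding graph_iso_def P4_def graph_of_def by (auto simp: V)
qed

lemma subgraph_graph_of_path4:
  assumes "is_path4 P" "simple_graph G" "P \<subseteq> edges G"
  shows "subgraph (graph_of P) G"
  using assms simple_graph_of_path4[OF assms(1)]
  by (auto simp: subgraph_def graph_of_def simple_graph_def)

text \<open>\<open>\<psi>\<close> is the inverse of the isomorphism: \<open>graph_iso\<close>
  supplies a map from \<open>G\<close> to \<open>H\<close>, whereas paths have to be carried from
  \<open>H\<close> back into \<open>G\<close>.\<close>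

lemma graph_iso_pullback:
  assumes "graph_iso G H" "simple_graph G"
  obtains \<psi> where "inj_on \<psi> (verts H)" "\<And>e. e \<in> edges H \<Longrightarrow> \<psi> ` e \<in> edges G"
proof -
  obtain \<phi> where \<phi>: "bij_betw \<phi> (verts G) (verts H)" "edges H = (\<lambda>e. \<phi> ` e) ` edges G"
    using assms(1) unfolding graph_iso_def by blast
  let ?\<psi> = "inv_into (verts G) \<phi>"
  have "inj_on ?\<psi> (verts H)"
    using \<phi>(1) bij_betw_inv_into bij_betw_imp_inj_on by blast
  moreover have "?\<psi> ` e \<in> edges G" if e_in: "e \<in> edges H" for e
  proof -
    obtain d where d: "d \<in> edges G" "e = \<phi> ` d"
      using e_in \<phi>(2) by blast
    moreover have "d \<subseteq> verts G"
      using assms(2) d(1) by (simp add: simple_graph_def)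
    ultimately show ?thesis
      using bij_betw_imp_inj_on[OF \<phi>(1)] by (simp add: inv_into_image_cancel)
  qed
  ultimately show ?thesis using that by blast
qed

lemma embeds_P4_iff:
  assumes "simple_graph G"
  shows "P4 \<lesssim>\<^sub>G G \<longleftrightarrow> (\<exists>P. is_path4 P \<and> P \<subseteq> edges G)"
proof
  assume "P4 \<lesssim>\<^sub>G G"
  then obtain S where S: "subgraph S G" "graph_iso S P4"
    unfolding embeds_def by blast
  then obtain \<psi> where \<psi>: "inj_on \<psi> (verts P4)" "\<And>e. e \<in> edges P4 \<Longrightarrow> \<psi> ` e \<in> edges S"
    using graph_iso_pullback[of S P4] unfolding subgraph_def by metis
  have "\<psi> ` {0, 1} \<in> edges S" "\<psi> ` {1, 2} \<in> edges S" "\<psi> ` {2, 3} \<in> edges S"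
    by (rule \<psi>(2), simp add: P4_def)+
  then have "path4 (\<psi> 0) (\<psi> 1) (\<psi> 2) (\<psi> 3) \<subseteq> edges G"
    using S(1) by (auto simp: path4_def subgraph_def)
  moreover have "distinct [\<psi> 0, \<psi> 1, \<psi> 2, \<psi> 3]"
    using \<psi>(1) by (auto simp: P4_def)
  ultimately show "\<exists>P. is_path4 P \<and> P \<subseteq> edges G"
    unfolding is_path4_def by blast
next
  assume "\<exists>P. is_path4 P \<and> P \<subseteq> edges G"
  then show "P4 \<lesssim>\<^sub>G G"
    using subgraph_graph_of_path4[OF _ assms] graph_iso_graph_of_path4
    unfolding embeds_def by blast
qed

text \<open>Supplies the path chosen in each block, and also a path in the copy of
  \<open>\<Gamma>\<close> inside the complete graph.\<close>

lemma iso_contains_path4: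
  assumes "P4 \<lesssim>\<^sub>G H" "graph_iso G H" "simple_graph G" "simple_graph H"
  obtains P where "is_path4 P" "P \<subseteq> edges G"
proof -
  obtain x y z w where d: "distinct [x, y, z, w]" and P: "path4 x y z w \<subseteq> edges H"
    using assms(1) embeds_P4_iff[OF assms(4)] unfolding is_path4_def by blast
  obtain \<psi> where \<psi>: "inj_on \<psi> (verts H)" "\<And>e. e \<in> edges H \<Longrightarrow> \<psi> ` e \<in> edges G"
    using graph_iso_pullback[OF assms(2,3)] by blast
  have "{x, y, z, w} \<subseteq> verts H"
    using P assms(4) by (auto simp: path4_def simple_graph_def)
  then have "distinct [\<psi> x, \<psi> y, \<psi> z, \<psi> w]"
    using d \<psi>(1) by (auto dest: inj_onD)
  moreover have "path4 (\<psi> x) (\<psi> y) (\<psi> z) (\<psi> w) \<subseteq> edges G"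
    using P \<psi>(2)[of "{x, y}"] \<psi>(2)[of "{y, z}"] \<psi>(2)[of "{z, w}"] by (simp add: path4_def)
  ultimately show ?thesis
    using that unfolding is_path4_def by blast
qed

section \<open>Completing a packing of paths to a design\<close>

lemma pairs_insert2:
  assumes "a \<noteq> b" "a \<notin> V" "b \<notin> V"
  shows "pairs (insert a (insert b V)) = pairs V \<union> spokes a b V \<union> {{a, b}}"
proof (intro subset_antisym subsetI)
  fix e assume "e \<in> pairs (insert a (insert b V))"
  then show "e \<in> pairs V \<union> spokes a b V \<union> {{a, b}}"
    by (auto simp: pairs_iff spokes_def insert_commute)
next
  fix e assume "e \<in> pairs V \<union> spokes a b V \<union> {{a, b}}"
  then show "e \<in> pairs (insert a (insert b V))"
    using assms by (auto simp: pairs_def spokes_def card_insert_if)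
qed

text \<open>Here the congruence on \<open>n\<close> becomes divisibility of the number of edges: 3
  divides \<open>n * (n - 1)\<close>, and 2 is prime to 3.\<close>

lemma three_dvd_choose_two:
  assumes "[n = 0] (mod 3) \<or> [n = 1] (mod 3)"
  shows "3 dvd n choose 2"
proof -
  have "3 dvd n \<or> 3 dvd n - 1"
    using assms unfolding cong_def by presburger
  then have "3 dvd n * (n - 1)"
    by auto
  moreover have "2 * (n choose 2) = n * (n - 1)"
    unfolding choose_two by (rule dvd_mult_div_cancel) auto
  ultimately show ?thesis
    by presburger
qed

text \<open>The bound \<open>card V + 2 \<le> n\<close> leaves room for two vertices
  \<open>a\<close> and \<open>b\<close> that no given path meets. The uncovered edges then have the
  form treated by \<open>decomposable_hub\<close>.\<close>

lemma path4_packing_extends: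
  fixes V :: "'a::infinite set"
  assumes "finite V" "partition_on U \<P>" "\<forall>P\<in>\<P>. is_path4 P" "U \<subseteq> pairs V"
    and "4 \<le> card V" "card V + 2 \<le> n" "3 dvd n choose 2"
  obtains N \<Q> where "finite N" "card N = n" "V \<subseteq> N" "\<P> \<subseteq> \<Q>"
    "partition_on (pairs N) \<Q>" "\<forall>P\<in>\<Q>. is_path4 P"
proof -
  have "infinite (- V)"
    using assms(1) by (simp add: infinite_UNIV)
  \<comment> \<open>\<open>W\<close> fills the vertex set up to \<open>n - 2\<close> elements,
    keeping two places for \<open>a\<close> and \<open>b\<close>.\<close>
  then obtain W where W: "finite W" "card W = n - 2 - card V" "W \<subseteq> - V"
    using infinite_arbitrarily_large by blast
  define V' where "V' = V \<union> W"
  have V': "finite V'" "V \<subseteq> V'"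
    using assms(1) W(1) by (auto simp: V'_def)
  have card_V': "card V' = n - 2"
    using assms(1,6) W card_Un_disjoint[of V W] unfolding V'_def by fastforce
  obtain a where a: "a \<notin> V'"
    using ex_new_if_finite[OF infinite_UNIV V'(1)] by blast
  obtain b where b: "b \<notin> insert a V'"
    using ex_new_if_finite[OF infinite_UNIV, of "insert a V'"] V'(1) by blast
  define N where "N = insert a (insert b V')"
  have N: "finite N" "card N = n"
    using V'(1) card_V' a b assms(5,6) by (auto simp: N_def)
  have ab: "a \<noteq> b" "b \<notin> V'"
    using b by auto
  have UV': "U \<subseteq> pairs V'"
    using assms(4) V'(2) by (auto simp: pairs_def)
  let ?R = "(pairs V' - U) \<union> spokes a b V' \<union> {{a, b}}"
  have eq: "pairs N = U \<union> ?R"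
    unfolding N_def pairs_insert2[OF ab(1) a ab(2)] using UV' by blast
  have disj: "U \<inter> ?R = {}"
    using UV' pairs_Int_spokes[OF a ab(2), of V'] a by (auto simp: pairs_def)
  have dU: "path4_decomposable U"
    using assms(2,3) unfolding path4_decomposable_def by blast
  have "card (pairs N) = n choose 2"
    using n_subsets[OF N(1), of 2] N(2) by (simp add: pairs_def)
  then have "3 dvd card ?R"
    using dvd_card_remove[OF dU _ disj] finite_pairs[OF N(1)] assms(7) unfolding eq by metis
  then have "path4_decomposable ?R"
    using V'(1) a ab card_V' assms(5,6) by (intro decomposable_hub) auto
  then obtain \<R> where R: "partition_on ?R \<R>" "\<forall>P\<in>\<R>. is_path4 P"
    unfolding path4_decomposable_def by blast
  have "partition_on (pairs N) (\<P> \<union> \<R>)"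
    unfolding eq by (rule partition_on_Un_disjoint[OF assms(2) R(1) disj])
  moreover have "\<forall>P\<in>\<P> \<union> \<R>. is_path4 P"
    using assms(3) R(2) by blast
  moreover have "V \<subseteq> N"
    using V'(2) by (auto simp: N_def)
  ultimately show ?thesis
    using that[OF N] by blast
qed

text \<open>A nonempty \<open>\<Q>\<close> supplies the embedding of \<open>P4\<close> into the
  complete graph that \<open>design\<close> demands.\<close>

lemma design_of_path4_partition:
  assumes "finite N" "partition_on (pairs N) \<Q>" "\<forall>P\<in>\<Q>. is_path4 P" "\<Q> \<noteq> {}"
  shows "design_of_order (card N) P4 (graph_of ` \<Q>)"
proof -
  have sub: "P \<subseteq> edges (complete_graph N)" if "P \<in> \<Q>" for P
    using that assms(2) by (auto simp: partition_on_def edges_complete_graph)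
  have "P4 \<lesssim>\<^sub>G complete_graph N"
    using embeds_P4_iff[OF simple_complete_graph[OF assms(1)]] assms(3,4) sub by blast
  moreover have "subgraph B (complete_graph N) \<and> graph_iso B P4" if "B \<in> graph_of ` \<Q>" for B
    using that assms(3) subgraph_graph_of_path4[OF _ simple_complete_graph[OF assms(1)]]
      graph_iso_graph_of_path4 sub by blast
  moreover have "inj_on edges (graph_of ` \<Q>)"
    by (auto simp: inj_on_def)
  moreover have "partition_on (edges (complete_graph N)) (edges ` graph_of ` \<Q>)"
    using assms(2) by (simp add: image_image edges_complete_graph)
  ultimately have "design (complete_graph N) P4 (graph_of ` \<Q>)"
    unfolding design_def by blast
  then show ?thesis
    unfolding design_of_order_def using assms(1) by blast
qed

text \<open>Blocks have disjoint edge sets, so one path chosen from each block gives a packing. It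
  is extended to a design on \<open>n\<close> vertices, and the down-link sends each block to its
  own path.\<close>

lemma down_linked_path4_design:
  fixes \<Gamma> :: "'a::infinite graph" and Bs :: "'a graph set"
  assumes "simple_graph \<Gamma>" "P4 \<lesssim>\<^sub>G \<Gamma>" "design_of_order v \<Gamma> Bs"
    and "v + 2 \<le> n" "3 dvd n choose 2"
  shows "\<exists>Bs'. design_of_order n P4 Bs' \<and> down_linked Bs Bs'"
proof -
  obtain V where V: "finite V" "card V = v" and D: "design (complete_graph V) \<Gamma> Bs"
    using assms(3) unfolding design_of_order_def by blast
  have B: "subgraph B (complete_graph V)" "graph_iso B \<Gamma>" "simple_graph B" if "B \<in> Bs" for B
    using that D by (auto simp: design_def subgraph_def)
  have inj: "inj_on edges Bs" and part: "partition_on (pairs V) (edges ` Bs)"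
    using D by (auto simp: design_def edges_complete_graph)
  have "\<forall>B\<in>Bs. \<exists>P. is_path4 P \<and> P \<subseteq> edges B"
    using iso_contains_path4[OF assms(2) B(2,3) assms(1)] by metis
  then obtain f where f: "\<And>B. B \<in> Bs \<Longrightarrow> is_path4 (f B)" "\<And>B. B \<in> Bs \<Longrightarrow> f B \<subseteq> edges B"
    by metis
  \<comment> \<open>The copy of \<open>\<Gamma>\<close> guaranteed by \<open>design\<close> puts a
    path into the complete graph on \<open>V\<close>; hence \<open>V\<close> has at least four
    elements and there is at least one block.\<close>
  obtain S where S: "subgraph S (complete_graph V)" "graph_iso S \<Gamma>"
    using D unfolding design_def embeds_def by blast
  then obtain P where P: "is_path4 P" "P \<subseteq> edges S"
    using iso_contains_path4[OF assms(2) S(2) _ assms(1)] unfolding subgraph_def by blast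
  obtain x y z w where d: "distinct [x, y, z, w]" and Pp: "P = path4 x y z w"
    using P(1) unfolding is_path4_def by blast
  have PV: "P \<subseteq> pairs V"
    using P(2) S(1) by (auto simp: subgraph_def edges_complete_graph)
  then have "{x, y, z, w} \<subseteq> V"
    by (auto simp: Pp path4_def pairs_def)
  then have "card {x, y, z, w} \<le> card V"
    using V(1) by (intro card_mono)
  then have card_V: "4 \<le> card V"
    using d by simp
  have "Bs \<noteq> {}"
    using part PV by (auto simp: partition_on_def Pp path4_def)
  have "partition_on (\<Union>(f ` Bs)) (f ` Bs)"
  proof (rule partition_onI)
    show "disjnt p q" if pq: "p \<in> f ` Bs" "q \<in> f ` Bs" "p \<noteq> q" for p q
    proof -
      obtain B C where BC: "B \<in> Bs" "p = f B" "C \<in> Bs" "q = f C" "B \<noteq> C"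
        using pq by blast
      \<comment> \<open>Injectivity of \<open>edges\<close> on the blocks makes distinct blocks give
        distinct, hence disjoint, parts of the partition.\<close>
      then have "edges B \<noteq> edges C"
        using inj by (auto dest: inj_onD)
      then have "edges B \<inter> edges C = {}"
        using part BC(1,3) by (auto simp: partition_on_def dest: disjointD)
      then show ?thesis
        using f(2)[OF BC(1)] f(2)[OF BC(3)] unfolding BC(2,4) disjnt_def by blast
    qed
    show "{} \<notin> f ` Bs"
      using f(1) by (force simp: is_path4_def path4_def)
  qed simp
  moreover have "\<Union>(f ` Bs) \<subseteq> pairs V"
    using f(2) part by (fastforce simp: partition_on_def)
  moreover have "\<forall>P\<in>f ` Bs. is_path4 P"
    using f(1) by blast
  moreover have "card V + 2 \<le> n"
    using assms(4) V(2) by simp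
  ultimately obtain N \<Q> where N: "finite N" "card N = n" and Q: "f ` Bs \<subseteq> \<Q>"
    "partition_on (pairs N) \<Q>" "\<forall>P\<in>\<Q>. is_path4 P"
    using path4_packing_extends[OF V(1), of "\<Union>(f ` Bs)" "f ` Bs" n] card_V assms(5)
    by metis
  have "\<Q> \<noteq> {}"
    using Q(1) \<open>Bs \<noteq> {}\<close> by blast
  then have "design_of_order n P4 (graph_of ` \<Q>)"
    using design_of_path4_partition[OF N(1) Q(2,3)] N(2) by simp
  moreover have "down_link (\<lambda>B. graph_of (f B)) Bs (graph_of ` \<Q>)"
    unfolding down_link_def
  proof (intro conjI ballI)
    show "(\<lambda>B. graph_of (f B)) \<in> Bs \<rightarrow> graph_of ` \<Q>"
      using Q(1) by auto
    show "subgraph (graph_of (f B)) B" if "B \<in> Bs" for B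
      by (rule subgraph_graph_of_path4[OF f(1)[OF that] B(3)[OF that] f(2)[OF that]])
  qed
  ultimately show ?thesis
    unfolding down_linked_def by blast
qed

theorem corollary3p2:
  fixes \<Gamma> :: "'a::infinite graph" and v :: nat
  assumes "simple_graph \<Gamma>"
    and "P4 \<lesssim>\<^sub>G \<Gamma>"
    and "\<exists>Bs :: 'a graph set. design_of_order v \<Gamma> Bs"
  shows "{n. n \<ge> v + 2 \<and> ([n = 0] (mod 3) \<or> [n = 1] (mod 3))} \<subseteq> L2 \<Gamma> v \<and> L2 \<Gamma> v \<subseteq> L1 \<Gamma> v"
proof
  show "{n. n \<ge> v + 2 \<and> ([n = 0] (mod 3) \<or> [n = 1] (mod 3))} \<subseteq> L2 \<Gamma> v"
    using down_linked_path4_design[OF assms(1,2)] three_dvd_choose_two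
    unfolding L2_def by blast
  \<comment> \<open>The assumed source design keeps the universal condition in \<open>L2\<close>
    from being vacuous.\<close>
  show "L2 \<Gamma> v \<subseteq> L1 \<Gamma> v"
    using assms(3) unfolding L1_def L2_def by blast
qed

end
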